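(* There exist a quantum channel $\Lambda$ and an entanglement breaking channel $\Phi$ such that $\Lambda$ provides no advantage under the action of the quantum switch (that is, $\Lambda$ is entanglement breaking and both branches $C_{+,\Lambda,\Lambda}$ and $C_{-,\Lambda,\Lambda}$ are entanglement breaking CP maps), but the concatenated channel $\Phi\circ\Lambda$ is useful under the action of the quantum switch (that is, at least one of the branches $C_{+,\Phi\circ\Lambda,\Phi\circ\Lambda}$, $C_{-,\Phi\circ\Lambda,\Phi\circ\Lambda}$ is not an entanglement breaking CP map).
   Context: A quantum channel is a completely positive trace-preserving linear map on operators on a finite-dimensional Hilbert space. For a channel $\Lambda$ with Kraus operators $\{\mathcal{A}_x\}$, the quantum switch applied to two copies of $\Lambda$ with control qubit state $\omega$ has Kraus operators $\mathcal{A}_x\mathcal{A}_y\otimes|0\rangle\langle 0|+\mathcal{A}_y\mathcal{A}_x\otimes|1\rangle\langle 1|$ and yields $$\mathsf{S}_{\Lambda,\Lambda,\omega}(\rho)=C_{+,\Lambda,\Lambda}(\rho)\otimes\omega+C_{-,\Lambda,\Lambda}(\rho)\otimes\sigma_z\omega\sigma_z,$$ where the branches are the CP maps $C_{+,\Lambda,\Lambda}(\rho)=\frac14\sum_{x,y}\{\mathcal{A}_x,\mathcal{A}_y\}\rho\{\mathcal{A}_x,\mathcal{A}_y\}^\dagger$ and $C_{-,\Lambda,\Lambda}(\rho)=\frac14\sum_{x,y}[\mathcal{A}_x,\mathcal{A}_y]\rho[\mathcal{A}_x,\mathcal{A}_y]^\dagger$. A CP linear map is entanglement breaking (EB) if its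 Choi matrix is separable, i.e. a finite sum of tensor products of positive semidefinite operators (the zero map counts as EB). A channel is an entanglement breaking channel (EBC) if it is an EB CP map. Usefulness here refers to the transfer of entanglement: a channel is useless if it is an EBC, and a useless channel remains useless under the switch (is completely useless) if both of its branches are EB CP maps. *)

theory Defs
  imports "Jordan_Normal_Form.Schur_Decomposition"
begin

text \<open>
  The operators on a Hilbert space of dimension \<open>d\<close> are the complex matrices in
  \<open>carrier_mat d d\<close>; a map on operators is a function on matrices of which only the
  values on \<open>carrier_mat d d\<close> matter.
\<close>

definition sum_mats :: "nat \<Rightarrow> complex mat list \<Rightarrow> complex mat" where
  "sum_mats n Ms = foldr (+) Ms (0\<^sub>m n n)"

definition mat_unit :: "nat \<Rightarrow> nat \<Rightarrow> nat \<Rightarrow> complex mat" where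
  "mat_unit n i j = mat n n (\<lambda>(k, l). if k = i \<and> l = j then 1 else 0)"

definition mat_trace :: "complex mat \<Rightarrow> complex" where
  "mat_trace M = (\<Sum>i<dim_row M. M $$ (i, i))"

definition kron :: "complex mat \<Rightarrow> complex mat \<Rightarrow> complex mat" where
  "kron A B = mat (dim_row A * dim_row B) (dim_col A * dim_col B)
     (\<lambda>(i, j). A $$ (i div dim_row B, j div dim_col B) * B $$ (i mod dim_row B, j mod dim_col B))"

text \<open>The order on \<open>complex\<close> is the one of \<open>HOL-Library.Complex_Order\<close>: \<open>0 \<le> z\<close> says that
  \<open>z\<close> is real and nonnegative. Hence hermiticity is implied.\<close>

definition psd :: "nat \<Rightarrow> complex mat \<Rightarrow> bool" where
  "psd n M \<longleftrightarrow> M \<in> carrier_mat n n \<and> (\<forall>v \<in> carrier_vec n. 0 \<le> (M *\<^sub>v v) \<bullet>c v)"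

definition linear_map :: "nat \<Rightarrow> (complex mat \<Rightarrow> complex mat) \<Rightarrow> bool" where
  "linear_map d E \<longleftrightarrow>
     (\<forall>X \<in> carrier_mat d d. E X \<in> carrier_mat d d) \<and>
     (\<forall>X \<in> carrier_mat d d. \<forall>Y \<in> carrier_mat d d. E (X + Y) = E X + E Y) \<and>
     (\<forall>c. \<forall>X \<in> carrier_mat d d. E (c \<cdot>\<^sub>m X) = c \<cdot>\<^sub>m E X)"

text \<open>The block \<open>X\<^sub>a\<^sub>b\<close> of \<open>X = (\<Sum>a b. e\<^sub>a\<^sub>b \<otimes> X\<^sub>a\<^sub>b)\<close>, and \<open>(id\<^sub>n \<otimes> E) X = (\<Sum>a b. e\<^sub>a\<^sub>b \<otimes> E X\<^sub>a\<^sub>b)\<close>.\<close>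

definition block :: "nat \<Rightarrow> complex mat \<Rightarrow> nat \<Rightarrow> nat \<Rightarrow> complex mat" where
  "block d X a b = mat d d (\<lambda>(k, l). X $$ (a * d + k, b * d + l))"

definition ampliation ::
    "nat \<Rightarrow> nat \<Rightarrow> (complex mat \<Rightarrow> complex mat) \<Rightarrow> complex mat \<Rightarrow> complex mat" where
  "ampliation n d E X =
     sum_mats (n * d) [kron (mat_unit n a b) (E (block d X a b)). a \<leftarrow> [0..<n], b \<leftarrow> [0..<n]]"

definition cp_map :: "nat \<Rightarrow> (complex mat \<Rightarrow> complex mat) \<Rightarrow> bool" where
  "cp_map d E \<longleftrightarrow> linear_map d E \<and> (\<forall>n X. psd (n * d) X \<longrightarrow> psd (n * d) (ampliation n d E X))"

definition quantum_channel :: "nat \<Rightarrow> (complex mat \<Rightarrow> complex mat) \<Rightarrow> bool" where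
  "quantum_channel d E \<longleftrightarrow> cp_map d E \<and> (\<forall>X \<in> carrier_mat d d. mat_trace (E X) = mat_trace X)"

definition choi :: "nat \<Rightarrow> (complex mat \<Rightarrow> complex mat) \<Rightarrow> complex mat" where
  "choi d E =
     sum_mats (d * d) [kron (mat_unit d i j) (E (mat_unit d i j)). i \<leftarrow> [0..<d], j \<leftarrow> [0..<d]]"

definition separable :: "nat \<Rightarrow> complex mat \<Rightarrow> bool" where
  "separable d M \<longleftrightarrow>
     (\<exists>PQs. (\<forall>(P, Q) \<in> set PQs. psd d P \<and> psd d Q) \<and>
            M = sum_mats (d * d) (map (\<lambda>(P, Q). kron P Q) PQs))"

definition eb_cp_map :: "nat \<Rightarrow> (complex mat \<Rightarrow> complex mat) \<Rightarrow> bool" where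
  "eb_cp_map d E \<longleftrightarrow> cp_map d E \<and> separable d (choi d E)"

definition eb_channel :: "nat \<Rightarrow> (complex mat \<Rightarrow> complex mat) \<Rightarrow> bool" where
  "eb_channel d E \<longleftrightarrow> quantum_channel d E \<and> eb_cp_map d E"

definition kraus_sum :: "nat \<Rightarrow> complex mat list \<Rightarrow> complex mat \<Rightarrow> complex mat" where
  "kraus_sum d As \<rho> = sum_mats d [A * \<rho> * mat_adjoint A. A \<leftarrow> As]"

definition kraus_rep :: "nat \<Rightarrow> complex mat list \<Rightarrow> (complex mat \<Rightarrow> complex mat) \<Rightarrow> bool" where
  "kraus_rep d As E \<longleftrightarrow>
     set As \<subseteq> carrier_mat d d \<and> (\<forall>\<rho> \<in> carrier_mat d d. E \<rho> = kraus_sum d As \<rho>)"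

definition kraus_branch_plus :: "nat \<Rightarrow> complex mat list \<Rightarrow> complex mat \<Rightarrow> complex mat" where
  "kraus_branch_plus d As \<rho> = (1/4) \<cdot>\<^sub>m kraus_sum d [A * B + B * A. A \<leftarrow> As, B \<leftarrow> As] \<rho>"

definition kraus_branch_minus :: "nat \<Rightarrow> complex mat list \<Rightarrow> complex mat \<Rightarrow> complex mat" where
  "kraus_branch_minus d As \<rho> = (1/4) \<cdot>\<^sub>m kraus_sum d [A * B - B * A. A \<leftarrow> As, B \<leftarrow> As] \<rho>"

text \<open>The branches of the switch of two copies of \<open>\<Lambda>\<close>. They do not depend on the chosen
  Kraus operators: see \<open>branch_plus_eq\<close> and \<open>branch_minus_eq\<close> below.\<close>

definition branch_plus ::
    "nat \<Rightarrow> (complex mat \<Rightarrow> complex mat) \<Rightarrow> complex mat \<Rightarrow> complex mat" where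
  "branch_plus d \<Lambda> = kraus_branch_plus d (SOME As. kraus_rep d As \<Lambda>)"

definition branch_minus ::
    "nat \<Rightarrow> (complex mat \<Rightarrow> complex mat) \<Rightarrow> complex mat \<Rightarrow> complex mat" where
  "branch_minus d \<Lambda> = kraus_branch_minus d (SOME As. kraus_rep d As \<Lambda>)"

definition completely_useless :: "nat \<Rightarrow> (complex mat \<Rightarrow> complex mat) \<Rightarrow> bool" where
  "completely_useless d \<Lambda> \<longleftrightarrow>
     eb_channel d \<Lambda> \<and> eb_cp_map d (branch_plus d \<Lambda>) \<and> eb_cp_map d (branch_minus d \<Lambda>)"

definition useful_under_switch :: "nat \<Rightarrow> (complex mat \<Rightarrow> complex mat) \<Rightarrow> bool" where
  "useful_under_switch d \<Lambda> \<longleftrightarrow>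
     \<not> eb_cp_map d (branch_plus d \<Lambda>) \<or> \<not> eb_cp_map d (branch_minus d \<Lambda>)"

lemma sum_mats_carrier:
  "set Ms \<subseteq> carrier_mat n n \<Longrightarrow> sum_mats n Ms \<in> carrier_mat n n"
  unfolding sum_mats_def by (induction Ms) auto

lemma sum_mats_index:
  assumes "set Ms \<subseteq> carrier_mat n n" "i < n" "j < n"
  shows "sum_mats n Ms $$ (i, j) = (\<Sum>M\<leftarrow>Ms. M $$ (i, j))"
  using assms(1)
proof (induction Ms)
  case Nil
  then show ?case using assms by (simp add: sum_mats_def)
next
  case (Cons M Ms)
  then have "sum_mats n Ms \<in> carrier_mat n n" by (intro sum_mats_carrier) auto
  then show ?case using Cons assms by (auto simp: sum_mats_def)
qed

lemma adjoint_carrier: "A \<in> carrier_mat n m \<Longrightarrow> mat_adjoint A \<in> carrier_mat m n"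
  unfolding mat_adjoint_def by auto

lemma adjoint_index:
  "A \<in> carrier_mat n m \<Longrightarrow> i < m \<Longrightarrow> j < n \<Longrightarrow> mat_adjoint A $$ (i, j) = cnj (A $$ (j, i))"
  unfolding mat_adjoint_def by (auto simp: mat_of_rows_def)

lemma sandwich_index:
  assumes "A \<in> carrier_mat d d" "\<rho> \<in> carrier_mat d d" "i < d" "j < d"
  shows "(A * \<rho> * mat_adjoint A) $$ (i, j) =
    (\<Sum>l<d. \<Sum>k<d. \<rho> $$ (k, l) * (A $$ (i, k) * cnj (A $$ (j, l))))"
proof -
  define R where "R = A * \<rho>"
  have R: "R \<in> carrier_mat d d" using assms by (simp add: R_def)
  have R_index: "R $$ (i, l) = (\<Sum>k<d. A $$ (i, k) * \<rho> $$ (k, l))" if "l < d" for l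
    using assms that by (auto simp: R_def scalar_prod_def atLeast0LessThan)
  have "(R * mat_adjoint A) $$ (i, j) = (\<Sum>l<d. R $$ (i, l) * cnj (A $$ (j, l)))"
    using assms R adjoint_carrier[OF assms(1)]
    by (auto simp: scalar_prod_def atLeast0LessThan adjoint_index[OF assms(1)] intro!: sum.cong)
  also have "\<dots> = (\<Sum>l<d. (\<Sum>k<d. A $$ (i, k) * \<rho> $$ (k, l)) * cnj (A $$ (j, l)))"
    by (simp add: R_index)
  finally have "(A * \<rho> * mat_adjoint A) $$ (i, j) =
      (\<Sum>l<d. (\<Sum>k<d. A $$ (i, k) * \<rho> $$ (k, l)) * cnj (A $$ (j, l)))"
    by (simp add: R_def)
  then show ?thesis by (simp add: sum_distrib_right sum_distrib_left mult_ac)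
qed

definition kraus_coeff :: "complex mat list \<Rightarrow> nat \<Rightarrow> nat \<Rightarrow> nat \<Rightarrow> nat \<Rightarrow> complex" where
  "kraus_coeff As i k j l = (\<Sum>A\<leftarrow>As. A $$ (i, k) * cnj (A $$ (j, l)))"

lemma kraus_sum_carrier:
  assumes "set As \<subseteq> carrier_mat d d" "\<rho> \<in> carrier_mat d d"
  shows "kraus_sum d As \<rho> \<in> carrier_mat d d"
  unfolding kraus_sum_def using assms adjoint_carrier
  by (intro sum_mats_carrier) (auto intro!: mult_carrier_mat simp: subset_iff)

lemma sum_list_sum_swap:
  "(\<Sum>x\<leftarrow>xs. \<Sum>i\<in>I. f x i) = (\<Sum>i\<in>I. \<Sum>x\<leftarrow>xs. f x i :: complex)"
  by (induction xs) (auto simp: sum.distrib)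

lemma kraus_sum_index:
  assumes "set As \<subseteq> carrier_mat d d" "\<rho> \<in> carrier_mat d d" "i < d" "j < d"
  shows "kraus_sum d As \<rho> $$ (i, j) =
    (\<Sum>l<d. \<Sum>k<d. \<rho> $$ (k, l) * kraus_coeff As i k j l)"
proof -
  have "kraus_sum d As \<rho> $$ (i, j) = (\<Sum>A\<leftarrow>As. (A * \<rho> * mat_adjoint A) $$ (i, j))"
    unfolding kraus_sum_def using assms adjoint_carrier
    by (subst sum_mats_index) (auto intro!: mult_carrier_mat simp: subset_iff comp_def)
  also have "\<dots> = (\<Sum>A\<leftarrow>As. \<Sum>l<d. \<Sum>k<d. \<rho> $$ (k, l) * (A $$ (i, k) * cnj (A $$ (j, l))))"
    using assms by (intro arg_cong[where f = sum_list] map_cong refl sandwich_index) auto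
  finally show ?thesis
    by (simp add: sum_list_sum_swap sum_list_const_mult kraus_coeff_def)
qed

lemma kraus_coeff_unique:
  assumes "kraus_rep d As E" "kraus_rep d Bs E" "i < d" "j < d" "k < d" "l < d"
  shows "kraus_coeff As i k j l = kraus_coeff Bs i k j l"
proof -
  have *: "E (mat_unit d k l) $$ (i, j) = kraus_coeff Cs i k j l" if "kraus_rep d Cs E" for Cs
  proof -
    have c: "mat_unit d k l \<in> carrier_mat d d" by (simp add: mat_unit_def)
    have "E (mat_unit d k l) $$ (i, j) =
        (\<Sum>l'<d. \<Sum>k'<d. mat_unit d k l $$ (k', l') * kraus_coeff Cs i k' j l')"
      using that c assms(3,4) by (auto simp: kraus_rep_def kraus_sum_index)
    also have "\<dots> = (\<Sum>l'<d. \<Sum>k'<d. if k' = k then (if l' = l then kraus_coeff Cs i k j l else 0) else 0)"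
      by (intro sum.cong refl) (auto simp: mat_unit_def)
    finally show ?thesis using assms by simp
  qed
  show ?thesis using *[OF assms(1)] *[OF assms(2)] by simp
qed

text \<open>Summing \<open>(A B + c B A)\<^sub>i\<^sub>k\<close> times the conjugate of \<open>(A B + c B A)\<^sub>j\<^sub>l\<close> over all pairs of Kraus
  operators, for \<open>c = 1\<close> and \<open>c = -1\<close> at once.\<close>

lemma kraus_coeff_pairs:
  assumes "set As \<subseteq> carrier_mat d d" "i < d" "j < d" "k < d" "l < d"
    and F: "\<And>A B i k. A \<in> carrier_mat d d \<Longrightarrow> B \<in> carrier_mat d d \<Longrightarrow> i < d \<Longrightarrow> k < d \<Longrightarrow>
      F A B $$ (i, k) = (\<Sum>m<d. A $$ (i, m) * B $$ (m, k) + of_real c * (B $$ (i, m) * A $$ (m, k)))"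
  shows "kraus_coeff [F A B. A \<leftarrow> As, B \<leftarrow> As] i k j l =
    (\<Sum>m<d. \<Sum>n<d.
       kraus_coeff As i m j n * kraus_coeff As m k n l
       + of_real c * (kraus_coeff As i m n l * kraus_coeff As m k j n)
       + of_real c * (kraus_coeff As m k j n * kraus_coeff As i m n l)
       + of_real c * of_real c * (kraus_coeff As m k n l * kraus_coeff As i m j n))"
proof -
  have pairs: "(\<Sum>M\<leftarrow>[F A B. A \<leftarrow> Xs, B \<leftarrow> Ys]. g M) = (\<Sum>A\<leftarrow>Xs. \<Sum>B\<leftarrow>Ys. g (F A B))"
    for Xs Ys and g :: "complex mat \<Rightarrow> complex"
    by (induction Xs) (auto simp: comp_def)
  have prod: "(\<Sum>A\<leftarrow>As. f A) * (\<Sum>B\<leftarrow>As. g B) = (\<Sum>A\<leftarrow>As. \<Sum>B\<leftarrow>As. f A * g B)"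
    for f g :: "complex mat \<Rightarrow> complex"
    by (simp add: sum_list_const_mult sum_list_mult_const)
  have prod': "(\<Sum>A\<leftarrow>As. f A) * (\<Sum>B\<leftarrow>As. g B) = (\<Sum>A\<leftarrow>As. \<Sum>B\<leftarrow>As. f B * g A)"
    for f g :: "complex mat \<Rightarrow> complex"
    using prod[of g f] by (simp add: mult.commute)
  have "kraus_coeff [F A B. A \<leftarrow> As, B \<leftarrow> As] i k j l =
      (\<Sum>A\<leftarrow>As. \<Sum>B\<leftarrow>As. F A B $$ (i, k) * cnj (F A B $$ (j, l)))"
    unfolding kraus_coeff_def pairs ..
  also have "\<dots> = (\<Sum>A\<leftarrow>As. \<Sum>B\<leftarrow>As. \<Sum>m<d. \<Sum>n<d.
       (A $$ (i, m) * cnj (A $$ (j, n))) * (B $$ (m, k) * cnj (B $$ (n, l)))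
       + of_real c * ((A $$ (i, m) * cnj (A $$ (n, l))) * (B $$ (m, k) * cnj (B $$ (j, n))))
       + of_real c * ((A $$ (m, k) * cnj (A $$ (j, n))) * (B $$ (i, m) * cnj (B $$ (n, l))))
       + of_real c * of_real c * ((A $$ (m, k) * cnj (A $$ (n, l))) * (B $$ (i, m) * cnj (B $$ (j, n)))))"
  proof (intro arg_cong[where f = sum_list] map_cong refl)
    fix A B assume "A \<in> set As" "B \<in> set As"
    then have AB: "A \<in> carrier_mat d d" "B \<in> carrier_mat d d"
      using assms(1) by auto
    have "F A B $$ (i, k) * cnj (F A B $$ (j, l)) =
      (\<Sum>m<d. A $$ (i, m) * B $$ (m, k) + of_real c * (B $$ (i, m) * A $$ (m, k))) *
      (\<Sum>n<d. cnj (A $$ (j, n) * B $$ (n, l) + of_real c * (B $$ (j, n) * A $$ (n, l))))"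
      using assms(2-5) by (simp only: F[OF AB] cnj_sum)
    also have "\<dots> = (\<Sum>m<d. \<Sum>n<d.
      (A $$ (i, m) * B $$ (m, k) + of_real c * (B $$ (i, m) * A $$ (m, k))) *
      cnj (A $$ (j, n) * B $$ (n, l) + of_real c * (B $$ (j, n) * A $$ (n, l))))"
      by (rule sum_product)
    also have "\<dots> = (\<Sum>m<d. \<Sum>n<d.
       (A $$ (i, m) * cnj (A $$ (j, n))) * (B $$ (m, k) * cnj (B $$ (n, l)))
       + of_real c * ((A $$ (i, m) * cnj (A $$ (n, l))) * (B $$ (m, k) * cnj (B $$ (j, n))))
       + of_real c * ((A $$ (m, k) * cnj (A $$ (j, n))) * (B $$ (i, m) * cnj (B $$ (n, l))))
       + of_real c * of_real c * ((A $$ (m, k) * cnj (A $$ (n, l))) * (B $$ (i, m) * cnj (B $$ (j, n)))))"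
      by (intro sum.cong refl) (simp add: algebra_simps)
    finally show "F A B $$ (i, k) * cnj (F A B $$ (j, l)) = \<dots>" .
  qed
  also have "\<dots> = (\<Sum>m<d. \<Sum>n<d.
       kraus_coeff As i m j n * kraus_coeff As m k n l
       + of_real c * (kraus_coeff As i m n l * kraus_coeff As m k j n)
       + of_real c * (kraus_coeff As m k j n * kraus_coeff As i m n l)
       + of_real c * of_real c * (kraus_coeff As m k n l * kraus_coeff As i m j n))"
    unfolding kraus_coeff_def prod
    by (simp add: sum_list_sum_swap sum_list_addf sum_list_const_mult)
  finally show ?thesis .
qed

lemma kraus_sum_pairs_unique:
  assumes reps: "kraus_rep d As E" "kraus_rep d Bs E" and \<rho>: "\<rho> \<in> carrier_mat d d"
    and Fc: "\<And>A B. A \<in> carrier_mat d d \<Longrightarrow> B \<in> carrier_mat d d \<Longrightarrow> F A B \<in> carrier_mat d d"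
    and F: "\<And>A B i k. A \<in> carrier_mat d d \<Longrightarrow> B \<in> carrier_mat d d \<Longrightarrow> i < d \<Longrightarrow> k < d \<Longrightarrow>
      F A B $$ (i, k) = (\<Sum>m<d. A $$ (i, m) * B $$ (m, k) + of_real c * (B $$ (i, m) * A $$ (m, k)))"
  shows "kraus_sum d [F A B. A \<leftarrow> As, B \<leftarrow> As] \<rho> = kraus_sum d [F A B. A \<leftarrow> Bs, B \<leftarrow> Bs] \<rho>"
proof -
  have sub: "set As \<subseteq> carrier_mat d d" "set Bs \<subseteq> carrier_mat d d"
    using reps by (auto simp: kraus_rep_def)
  have sub': "set [F A B. A \<leftarrow> As, B \<leftarrow> As] \<subseteq> carrier_mat d d"
    "set [F A B. A \<leftarrow> Bs, B \<leftarrow> Bs] \<subseteq> carrier_mat d d"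
    using sub by (auto intro!: Fc dest: subsetD)
  have "kraus_coeff [F A B. A \<leftarrow> As, B \<leftarrow> As] i k j l = kraus_coeff [F A B. A \<leftarrow> Bs, B \<leftarrow> Bs] i k j l"
    if "i < d" "j < d" "k < d" "l < d" for i j k l
  proof -
    note pairs = kraus_coeff_pairs[where F = F and c = c, OF _ that]
    show ?thesis
      using pairs[OF sub(1)] pairs[OF sub(2)] F that by (simp add: kraus_coeff_unique[OF reps])
  qed
  then show ?thesis
    using kraus_sum_carrier[OF sub'(1) \<rho>] kraus_sum_carrier[OF sub'(2) \<rho>]
    by (intro eq_matI) (auto simp: kraus_sum_index[OF sub'(1) \<rho>] kraus_sum_index[OF sub'(2) \<rho>]
        simp del: set_concat intro!: sum.cong)
qed

lemma branch_plus_eq: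
  assumes "kraus_rep d As \<Lambda>" "\<rho> \<in> carrier_mat d d"
  shows "branch_plus d \<Lambda> \<rho> = kraus_branch_plus d As \<rho>"
proof -
  have "kraus_rep d (SOME As. kraus_rep d As \<Lambda>) \<Lambda>"
    using assms(1) by (rule someI)
  then show ?thesis unfolding branch_plus_def kraus_branch_plus_def
    by (intro arg_cong[where f = "smult_mat (1/4)"]
          kraus_sum_pairs_unique[where F = "\<lambda>A B. A * B + B * A" and c = 1 and E = \<Lambda>] assms)
       (auto simp: scalar_prod_def atLeast0LessThan sum.distrib
          intro!: add_carrier_mat mult_carrier_mat)
qed

lemma branch_minus_eq:
  assumes "kraus_rep d As \<Lambda>" "\<rho> \<in> carrier_mat d d"
  shows "branch_minus d \<Lambda> \<rho> = kraus_branch_minus d As \<rho>"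
proof -
  have "kraus_rep d (SOME As. kraus_rep d As \<Lambda>) \<Lambda>"
    using assms(1) by (rule someI)
  then show ?thesis unfolding branch_minus_def kraus_branch_minus_def
    by (intro arg_cong[where f = "smult_mat (1/4)"]
          kraus_sum_pairs_unique[where F = "\<lambda>A B. A * B - B * A" and c = "-1" and E = \<Lambda>] assms)
       (auto simp: scalar_prod_def atLeast0LessThan sum.distrib sum_negf sum_subtractf
          intro!: minus_carrier_mat mult_carrier_mat)
qed

end

(* A classical-to-classical channel with Kraus operators e_(p m, m) is entanglement breaking.
   For d = 2 and p = id (dephasing) the Kraus operators commute, so C_- = 0 and C_+ is the channel
   itself.  Composing with Phi given by the flip p gives Phi again, whose Kraus operators e_10 and
   e_01 have commutator e_11 - e_00: here C_- is half the unitary conjugation by sigma_z, which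
   is not entanglement breaking. *)
theory Submission
  imports Defs
begin

section \<open>Matrix units, Kronecker products and block indices\<close>

lemma mat_unit_carrier [simp]: "mat_unit n i j \<in> carrier_mat n n"
  by (simp add: mat_unit_def)

lemma mat_unit_dim [simp]: "dim_row (mat_unit n i j) = n" "dim_col (mat_unit n i j) = n"
  by (simp_all add: mat_unit_def)

lemma kron_carrier [intro]:
  "A \<in> carrier_mat n n \<Longrightarrow> B \<in> carrier_mat d d \<Longrightarrow> kron A B \<in> carrier_mat (n * d) (n * d)"
  by (auto simp: kron_def)

lemma less_mult_add: "a < n \<Longrightarrow> k < d \<Longrightarrow> a * d + k < n * (d::nat)"
  by (metis add_strict_left_mono add.commute less_le_trans mult_Suc mult_le_mono1 Suc_leI)

lemma kron_index:
  assumes "A \<in> carrier_mat n n" "B \<in> carrier_mat d d" "a < n" "b < n" "k < d" "l < d"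
  shows "kron A B $$ (a * d + k, b * d + l) = A $$ (a, b) * B $$ (k, l)"
  using assms less_mult_add[of a n k d] less_mult_add[of b n l d] by (auto simp: kron_def)

lemma sum_mult_group:
  fixes f :: "nat \<Rightarrow> 'a::comm_monoid_add"
  shows "(\<Sum>i<n * d. f i) = (\<Sum>a<n. \<Sum>k<d. f (a * d + k))"
proof -
  have "(\<Sum>k<d. f (a * d + k)) = sum f {a * d..<a * d + d}" for a
    using sum.shift_bounds_nat_ivl[of f 0 "a * d" d]
    by (simp add: atLeast0LessThan add.commute)
  then show ?thesis by (simp add: sum.nat_group)
qed

section \<open>Positive semidefinite matrices as quadratic forms\<close>

lemma psd_iff_quadratic_form:
  "psd n M \<longleftrightarrow> M \<in> carrier_mat n n \<and>
    (\<forall>f. 0 \<le> (\<Sum>i<n. \<Sum>j<n. M $$ (i, j) * (cnj (f i) * f j)))"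
proof (cases "M \<in> carrier_mat n n")
  case True
  have eq: "(M *\<^sub>v v) \<bullet>c v = (\<Sum>i<n. \<Sum>j<n. M $$ (i, j) * (cnj (v $ i) * v $ j))"
    if "v \<in> carrier_vec n" for v
    using that True
    by (auto simp: scalar_prod_def atLeast0LessThan sum_distrib_right sum_distrib_left mult_ac
        intro!: sum.cong)
  show ?thesis
  proof (intro iffI)
    assume "psd n M"
    \<comment> \<open>Only the values of \<open>f\<close> below \<open>n\<close> enter the form, so
      \<open>vec n f\<close> is the vector to test with.\<close>
    have "0 \<le> (\<Sum>i<n. \<Sum>j<n. M $$ (i, j) * (cnj (f i) * f j))" for f
    proof -
      have "0 \<le> (M *\<^sub>v vec n f) \<bullet>c vec n f"
        using \<open>psd n M\<close> by (simp add: psd_def)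
      then show ?thesis by (subst (asm) eq) auto
    qed
    then show "M \<in> carrier_mat n n \<and>
      (\<forall>f. 0 \<le> (\<Sum>i<n. \<Sum>j<n. M $$ (i, j) * (cnj (f i) * f j)))" using True by blast
  next
    assume "M \<in> carrier_mat n n \<and>
      (\<forall>f. 0 \<le> (\<Sum>i<n. \<Sum>j<n. M $$ (i, j) * (cnj (f i) * f j)))"
    then show "psd n M" by (auto simp: psd_def eq)
  qed
qed (simp add: psd_def)

lemma psd_quadratic_form:
  "psd n M \<Longrightarrow> 0 \<le> (\<Sum>i<n. \<Sum>j<n. M $$ (i, j) * (cnj (f i) * f j))"
  unfolding psd_iff_quadratic_form by simp

text \<open>A real affine function that stays nonnegative on the whole line has slope zero. Real
  \<open>c\<close> gives \<open>Re a + Re b = 0\<close>, imaginary \<open>c\<close> gives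
  \<open>Im a = Im b\<close>. The order on \<open>complex\<close> also forces the value to be real,
  and \<open>c = 1\<close> and \<open>c = \<i>\<close> then give \<open>a = cnj b\<close>; together
  these leave \<open>b = 0\<close>.\<close>

lemma affine_nonneg_imp_zero:
  fixes a b m :: complex
  assumes "\<And>c. 0 \<le> c * a + cnj c * b + m"
  shows "b = 0"
proof -
  have bounded: "x = 0" if "\<And>t::real. 0 \<le> t * x + y" for x y :: real
  proof (rule ccontr)
    assume "x \<noteq> 0"
    \<comment> \<open>At this \<open>t\<close> the function \<open>t * x + y\<close> takes the value
      -1.\<close>
    then show False using that[of "- (y + 1) / x"] by simp
  qed
  have m: "Im m = 0" using assms[of 0] by (simp add: less_eq_complex_def)
  have "Re a + Re b = 0"
  proof (rule bounded)
    show "0 \<le> t * (Re a + Re b) + Re m" for t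
      using assms[of "of_real t"] by (simp add: less_eq_complex_def algebra_simps)
  qed
  moreover have "Im b - Im a = 0"
  proof (rule bounded)
    show "0 \<le> t * (Im b - Im a) + Re m" for t
      using assms[of "\<i> * of_real t"] by (simp add: less_eq_complex_def algebra_simps)
  qed
  moreover have "Im a + Im b = 0" "Re a - Re b = 0"
    using assms[of 1] assms[of \<i>] m by (auto simp: less_eq_complex_def)
  ultimately show ?thesis by (auto simp: complex_eq_iff)
qed

lemma psd_diag_nonneg:
  assumes "psd n M" "i < n"
  shows "0 \<le> M $$ (i, i)"
proof -
  have "0 \<le> (\<Sum>k<n. \<Sum>l<n. M $$ (k, l) * (cnj (of_bool (k = i)) * of_bool (l = i)))"
    by (rule psd_quadratic_form[OF assms(1)])
  \<comment> \<open>The conditionals are nested with the inner summation index tested first, so that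
    simplification collapses one sum after the other.\<close>
  also have "\<dots> = (\<Sum>k<n. \<Sum>l<n. if l = i then if k = i then M $$ (i, i) else 0 else 0)"
    by (intro sum.cong refl) auto
  also have "\<dots> = M $$ (i, i)" using assms(2) by simp
  finally show ?thesis .
qed

text \<open>Test the form on the vector with entry \<open>c\<close> at \<open>i\<close> and 1 at
  \<open>j\<close>. Since the term in \<open>cnj c * c\<close> has coefficient
  \<open>M $$ (i, i) = 0\<close>, the form is affine in \<open>c\<close> and \<open>cnj c\<close>;
  being nonnegative for every \<open>c\<close>, it cannot depend on \<open>c\<close>.\<close>

lemma psd_zero_diag:
  assumes "psd n M" "i < n" "j < n" "M $$ (i, i) = 0"
  shows "M $$ (i, j) = 0" "M $$ (j, i) = 0"
proof -
  have "M $$ (i, j) = 0 \<and> M $$ (j, i) = 0"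
  proof (cases "i = j")
    case False
    have form: "0 \<le> c * M $$ (j, i) + cnj c * M $$ (i, j) + M $$ (j, j)" for c
    proof -
      let ?f = "\<lambda>k. (if k = i then c else 0) + (if k = j then 1 else 0)"
      have "0 \<le> (\<Sum>k<n. \<Sum>l<n. M $$ (k, l) * (cnj (?f k) * ?f l))"
        by (rule psd_quadratic_form[OF assms(1)])
      also have "\<dots> = (\<Sum>k<n. \<Sum>l<n.
          (if l = i then if k = i then M $$ (i, i) * (cnj c * c) else 0 else 0)
          + (if l = i then if k = j then c * M $$ (j, i) else 0 else 0)
          + (if l = j then if k = i then cnj c * M $$ (i, j) else 0 else 0)
          + (if l = j then if k = j then M $$ (j, j) else 0 else 0))"
        using False by (intro sum.cong refl) auto
      also have "\<dots> = c * M $$ (j, i) + cnj c * M $$ (i, j) + M $$ (j, j)"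
        using assms by (simp add: sum.distrib)
      finally show ?thesis .
    qed
    have "M $$ (i, j) = 0"
      using form by (rule affine_nonneg_imp_zero)
    moreover have "M $$ (j, i) = 0"
    proof (rule affine_nonneg_imp_zero)
      show "0 \<le> c * M $$ (i, j) + cnj c * M $$ (j, i) + M $$ (j, j)" for c
        \<comment> \<open>Conjugating \<open>c\<close> exchanges the roles of the two off-diagonal
          entries.\<close>
        using form[of "cnj c"] by (simp add: add_ac)
    qed
    ultimately show ?thesis by blast
  qed (use assms in simp)
  then show "M $$ (i, j) = 0" "M $$ (j, i) = 0" by auto
qed

lemma psd_mat_unit: "i < n \<Longrightarrow> psd n (mat_unit n i i)"
proof -
  assume i: "i < n"
  have "(\<Sum>k<n. \<Sum>l<n. mat_unit n i i $$ (k, l) * (cnj (f k) * f l)) = cnj (f i) * f i" for f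
  proof -
    have "(\<Sum>k<n. \<Sum>l<n. mat_unit n i i $$ (k, l) * (cnj (f k) * f l)) =
        (\<Sum>k<n. \<Sum>l<n. if l = i then if k = i then cnj (f i) * f i else 0 else 0)"
      by (intro sum.cong refl) (auto simp: mat_unit_def)
    then show ?thesis using i by simp
  qed
  moreover have "0 \<le> cnj z * z" for z :: complex
    by (simp add: less_eq_complex_def)
  ultimately show ?thesis by (simp add: psd_iff_quadratic_form)
qed

section \<open>Block entries of ampliations and Choi matrices, both of which are sums of Kronecker
  products with matrix units\<close>

lemma sum_mats_kron_units_index:
  assumes G: "\<And>a b. a < n \<Longrightarrow> b < n \<Longrightarrow> G a b \<in> carrier_mat d d"
    and "a < n" "b < n" "k < d" "l < d"
  shows "sum_mats (n * d) [kron (mat_unit n a b) (G a b). a \<leftarrow> [0..<n], b \<leftarrow> [0..<n]]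
    $$ (a * d + k, b * d + l) = G a b $$ (k, l)"
proof -
  have pairs: "(\<Sum>M\<leftarrow>[F a b. a \<leftarrow> xs, b \<leftarrow> ys]. g M) = (\<Sum>a\<leftarrow>xs. \<Sum>b\<leftarrow>ys. g (F a b))"
    for F :: "nat \<Rightarrow> nat \<Rightarrow> complex mat" and xs ys and g :: "complex mat \<Rightarrow> complex"
    by (induction xs) (auto simp: comp_def)
  have carrier: "set [kron (mat_unit n a b) (G a b). a \<leftarrow> [0..<n], b \<leftarrow> [0..<n]]
      \<subseteq> carrier_mat (n * d) (n * d)"
    using G by auto
  have "sum_mats (n * d) [kron (mat_unit n a b) (G a b). a \<leftarrow> [0..<n], b \<leftarrow> [0..<n]]
      $$ (a * d + k, b * d + l) =
    (\<Sum>a'\<leftarrow>[0..<n]. \<Sum>b'\<leftarrow>[0..<n]. kron (mat_unit n a' b') (G a' b') $$ (a * d + k, b * d + l))"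
    using assms less_mult_add by (subst sum_mats_index[OF carrier]) (auto simp: pairs)
  also have "\<dots> = (\<Sum>a'<n. \<Sum>b'<n. mat_unit n a' b' $$ (a, b) * G a' b' $$ (k, l))"
    unfolding interv_sum_list_conv_sum_set_nat
    using assms by (auto simp: atLeast0LessThan kron_index[OF mat_unit_carrier G] intro!: sum.cong)
  \<comment> \<open>Only the summand with \<open>(a', b') = (a, b)\<close> reaches block
    \<open>(a, b)\<close>.\<close>
  also have "\<dots> = (\<Sum>a'<n. \<Sum>b'<n. if b' = b then if a' = a then G a b $$ (k, l) else 0 else 0)"
    using assms by (intro sum.cong refl) (auto simp: mat_unit_def)
  also have "\<dots> = G a b $$ (k, l)"
    using assms by simp
  finally show ?thesis .
qed

lemma ampliation_index:
  assumes "linear_map d E" "a < n" "b < n" "k < d" "l < d"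
  shows "ampliation n d E X $$ (a * d + k, b * d + l) = E (block d X a b) $$ (k, l)"
  unfolding ampliation_def using assms
  by (intro sum_mats_kron_units_index) (auto simp: linear_map_def block_def)

lemma ampliation_carrier:
  "linear_map d E \<Longrightarrow> ampliation n d E X \<in> carrier_mat (n * d) (n * d)"
  unfolding ampliation_def
  by (intro sum_mats_carrier) (auto simp: linear_map_def block_def intro!: kron_carrier)

lemma choi_index:
  assumes "linear_map d E" "i < d" "j < d" "k < d" "l < d"
  shows "choi d E $$ (i * d + k, j * d + l) = E (mat_unit d i j) $$ (k, l)"
  unfolding choi_def using assms
  by (intro sum_mats_kron_units_index) (auto simp: linear_map_def)

lemma choi_carrier:
  "linear_map d E \<Longrightarrow> choi d E \<in> carrier_mat (d * d) (d * d)"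
  unfolding choi_def by (intro sum_mats_carrier) (auto simp: linear_map_def intro!: kron_carrier)

lemma eq_mat_blockI:
  assumes "A \<in> carrier_mat (n * d) (n * d)" "B \<in> carrier_mat (n * d) (n * d)"
    and "\<And>a b k l. a < n \<Longrightarrow> b < n \<Longrightarrow> k < d \<Longrightarrow> l < d \<Longrightarrow>
      A $$ (a * d + k, b * d + l) = B $$ (a * d + k, b * d + l)"
  shows "A = B"
proof (rule eq_matI)
  fix i j assume "i < dim_row B" "j < dim_col B"
  then have ij: "i < n * d" "j < n * d" using assms by auto
  \<comment> \<open>For \<open>d = 0\<close> there would be no index below \<open>n * d\<close>;
    positivity makes the remainders modulo \<open>d\<close> valid positions in a block.\<close>
  then have "0 < d" by (cases d) auto
  with ij have "i div d < n" "j div d < n" "i mod d < d" "j mod d < d"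
    by (auto simp: less_mult_imp_div_less)
  from assms(3)[OF this] show "A $$ (i, j) = B $$ (i, j)" by simp
qed (use assms in auto)

section \<open>Kraus sums as completely positive maps\<close>

lemma linear_map_kraus_sum:
  assumes "set As \<subseteq> carrier_mat d d"
  shows "linear_map d (kraus_sum d As)"
  unfolding linear_map_def
proof (intro conjI ballI allI)
  fix X Y :: "complex mat" and c
  assume X: "X \<in> carrier_mat d d" and Y: "Y \<in> carrier_mat d d"
  note carrier = kraus_sum_carrier[OF assms]
  show "kraus_sum d As X \<in> carrier_mat d d" by (rule carrier[OF X])
  show "kraus_sum d As (X + Y) = kraus_sum d As X + kraus_sum d As Y"
    using X Y carrier[OF X] carrier[OF Y] carrier[of "X + Y"]
    by (intro eq_matI) (auto simp: kraus_sum_index[OF assms] algebra_simps sum.distrib)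
  show "kraus_sum d As (c \<cdot>\<^sub>m X) = c \<cdot>\<^sub>m kraus_sum d As X"
    using X carrier[OF X] carrier[of "c \<cdot>\<^sub>m X"]
    by (intro eq_matI) (auto simp: kraus_sum_index[OF assms] sum_distrib_left mult_ac)
qed

text \<open>The form of the ampliated matrix at \<open>f\<close> is the sum, over the Kraus
  operators \<open>A\<close>, of the form of \<open>X\<close> at the vector obtained from
  \<open>f\<close> by applying the adjoint of \<open>A\<close> to the second tensor factor. Each
  summand is nonnegative because \<open>X\<close> is positive semidefinite.\<close>

lemma cp_map_kraus_sum:
  assumes As: "set As \<subseteq> carrier_mat d d"
  shows "cp_map d (kraus_sum d As)"
  unfolding cp_map_def
proof (intro conjI allI impI)
  note lin = linear_map_kraus_sum[OF As]
  then show "linear_map d (kraus_sum d As)" .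
  fix n X assume X: "psd (n * d) X"
  have "0 \<le> (\<Sum>i<n * d. \<Sum>j<n * d. ampliation n d (kraus_sum d As) X $$ (i, j) * (cnj (f i) * f j))"
    for f
  proof -
    \<comment> \<open>\<open>g A\<close> lists the coordinates of the identity tensor the adjoint of
      \<open>A\<close>, applied to \<open>f\<close>.\<close>
    define g where "g A i = (\<Sum>k<d. cnj (A $$ (k, i mod d)) * f (i div d * d + k))"
      for A :: "complex mat" and i
    have "(\<Sum>i<n * d. \<Sum>j<n * d. ampliation n d (kraus_sum d As) X $$ (i, j) * (cnj (f i) * f j)) =
       (\<Sum>a<n. \<Sum>k<d. \<Sum>b<n. \<Sum>l<d. (\<Sum>q<d. \<Sum>p<d. X $$ (a * d + p, b * d + q) *
          (\<Sum>A\<leftarrow>As. A $$ (k, p) * cnj (A $$ (l, q)))) * (cnj (f (a * d + k)) * f (b * d + l)))"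
      unfolding sum_mult_group
      by (intro sum.cong refl)
         (simp add: ampliation_index[OF lin] kraus_sum_index[OF As] block_def kraus_coeff_def)
    also have "\<dots> = (\<Sum>a<n. \<Sum>k<d. \<Sum>b<n. \<Sum>l<d. \<Sum>q<d. \<Sum>p<d. \<Sum>A\<leftarrow>As. X $$ (a * d + p, b * d + q) *
          (A $$ (k, p) * cnj (A $$ (l, q))) * (cnj (f (a * d + k)) * f (b * d + l)))"
      by (simp add: sum_distrib_right sum_list_const_mult sum_list_mult_const)
    also have "\<dots> = (\<Sum>A\<leftarrow>As. \<Sum>a<n. \<Sum>k<d. \<Sum>b<n. \<Sum>l<d. \<Sum>q<d. \<Sum>p<d. X $$ (a * d + p, b * d + q) *
          (A $$ (k, p) * cnj (A $$ (l, q))) * (cnj (f (a * d + k)) * f (b * d + l)))"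
      by (simp add: sum_list_sum_swap)
    also have "\<dots> = (\<Sum>A\<leftarrow>As. \<Sum>i<n * d. \<Sum>j<n * d. X $$ (i, j) * (cnj (g A i) * g A j))"
    proof (intro arg_cong[where f = sum_list] map_cong refl)
      fix A
      let ?t = "\<lambda>a k b l q p. X $$ (a * d + p, b * d + q) *
          (A $$ (k, p) * cnj (A $$ (l, q))) * (cnj (f (a * d + k)) * f (b * d + l))"
      \<comment> \<open>The sums over \<open>k\<close> and \<open>l\<close> have to become
        innermost, where they form the two factors of \<open>g A\<close>. Each exchange below swaps
        one adjacent pair of sums.\<close>
      have "(\<Sum>a<n. \<Sum>k<d. \<Sum>b<n. \<Sum>l<d. \<Sum>q<d. \<Sum>p<d. ?t a k b l q p) =
        (\<Sum>a<n. \<Sum>p<d. \<Sum>b<n. \<Sum>q<d. \<Sum>k<d. \<Sum>l<d. ?t a k b l q p)"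
      proof (rule sum.cong[OF refl])
        fix a
        have "(\<Sum>k<d. \<Sum>b<n. \<Sum>l<d. \<Sum>q<d. \<Sum>p<d. ?t a k b l q p) =
            (\<Sum>k<d. \<Sum>b<n. \<Sum>l<d. \<Sum>p<d. \<Sum>q<d. ?t a k b l q p)"
          by (intro sum.cong refl sum.swap)
        also have "\<dots> = (\<Sum>k<d. \<Sum>b<n. \<Sum>p<d. \<Sum>l<d. \<Sum>q<d. ?t a k b l q p)"
          by (intro sum.cong refl sum.swap)
        also have "\<dots> = (\<Sum>k<d. \<Sum>p<d. \<Sum>b<n. \<Sum>l<d. \<Sum>q<d. ?t a k b l q p)"
          by (intro sum.cong refl sum.swap)
        also have "\<dots> = (\<Sum>p<d. \<Sum>k<d. \<Sum>b<n. \<Sum>l<d. \<Sum>q<d. ?t a k b l q p)"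
          by (rule sum.swap)
        also have "\<dots> = (\<Sum>p<d. \<Sum>b<n. \<Sum>k<d. \<Sum>l<d. \<Sum>q<d. ?t a k b l q p)"
          by (intro sum.cong refl sum.swap)
        also have "\<dots> = (\<Sum>p<d. \<Sum>b<n. \<Sum>k<d. \<Sum>q<d. \<Sum>l<d. ?t a k b l q p)"
          by (intro sum.cong refl sum.swap)
        also have "\<dots> = (\<Sum>p<d. \<Sum>b<n. \<Sum>q<d. \<Sum>k<d. \<Sum>l<d. ?t a k b l q p)"
          by (intro sum.cong refl sum.swap)
        finally show "(\<Sum>k<d. \<Sum>b<n. \<Sum>l<d. \<Sum>q<d. \<Sum>p<d. ?t a k b l q p) = \<dots>" .
      qed
      \<comment> \<open>For \<open>p < d\<close>, dividing \<open>a * d + p\<close> by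
        \<open>d\<close> gives quotient \<open>a\<close> and remainder \<open>p\<close>, so
        \<open>g A\<close> at this index is a sum over \<open>k\<close> alone.\<close>
      also have "\<dots> = (\<Sum>a<n. \<Sum>p<d. \<Sum>b<n. \<Sum>q<d. X $$ (a * d + p, b * d + q) *
          (cnj (g A (a * d + p)) * g A (b * d + q)))"
        by (intro sum.cong refl)
           (simp add: g_def sum_product, simp add: sum_distrib_left mult_ac)
      also have "\<dots> = (\<Sum>i<n * d. \<Sum>j<n * d. X $$ (i, j) * (cnj (g A i) * g A j))"
        by (simp add: sum_mult_group)
      finally show "(\<Sum>a<n. \<Sum>k<d. \<Sum>b<n. \<Sum>l<d. \<Sum>q<d. \<Sum>p<d. ?t a k b l q p) = \<dots>" .
    qed
    also have "0 \<le> \<dots>"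
      by (rule sum_list_nonneg) (auto intro: psd_quadratic_form[OF X])
    finally show ?thesis .
  qed
  then show "psd (n * d) (ampliation n d (kraus_sum d As) X)"
    unfolding psd_iff_quadratic_form using ampliation_carrier[OF lin] by blast
qed

text \<open>Every block of a matrix lies in \<open>carrier_mat d d\<close>, so the ampliation sees
  no other values of the map. This matters because the branches of the switch are only determined on
  that carrier.\<close>

lemma cp_map_cong:
  assumes "cp_map d E" and eq: "\<And>X. X \<in> carrier_mat d d \<Longrightarrow> F X = E X"
  shows "cp_map d F"
proof -
  have "ampliation n d F X = ampliation n d E X" for n X
    using eq[of "block d X _ _"] by (simp add: ampliation_def block_def)
  moreover have "linear_map d F"
    using assms by (simp add: cp_map_def linear_map_def)
  ultimately show ?thesis using assms(1) by (simp add: cp_map_def)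
qed

lemma eb_cp_map_cong:
  assumes "eb_cp_map d E" and eq: "\<And>X. X \<in> carrier_mat d d \<Longrightarrow> F X = E X"
  shows "eb_cp_map d F"
  using assms cp_map_cong[of d E F] by (simp add: eb_cp_map_def choi_def)

section \<open>An obstruction to separability\<close>

lemma separable_index:
  assumes "\<forall>(P, Q) \<in> set PQs. psd d P \<and> psd d Q" "i < d" "j < d" "k < d" "l < d"
  shows "sum_mats (d * d) (map (\<lambda>(P, Q). kron P Q) PQs) $$ (i * d + k, j * d + l) =
    (\<Sum>(P, Q)\<leftarrow>PQs. P $$ (i, j) * Q $$ (k, l))"
proof -
  have carrier: "P \<in> carrier_mat d d" "Q \<in> carrier_mat d d" if "(P, Q) \<in> set PQs" for P Q
    using assms(1) that by (auto simp: psd_def)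
  have "sum_mats (d * d) (map (\<lambda>(P, Q). kron P Q) PQs) $$ (i * d + k, j * d + l) =
      (\<Sum>M\<leftarrow>map (\<lambda>(P, Q). kron P Q) PQs. M $$ (i * d + k, j * d + l))"
    using assms less_mult_add by (intro sum_mats_index) (auto intro!: kron_carrier dest: carrier)
  also have "\<dots> = (\<Sum>(P, Q)\<leftarrow>PQs. P $$ (i, j) * Q $$ (k, l))"
    unfolding map_map comp_def
    using assms(2-) by (intro arg_cong[where f = sum_list] map_cong refl)
      (auto simp: kron_index[OF carrier])
  finally show ?thesis .
qed

text \<open>This is positivity of the partial transpose, in entries: transposing the second factor
  moves the entry in question to row \<open>(i, l)\<close> and column \<open>(j, k)\<close>, a row
  whose diagonal entry is zero. The proof works directly on the products \<open>P\<close>,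
  \<open>Q\<close> of a separable decomposition.\<close>

lemma separable_zero_diag:
  assumes "separable d M" "i < d" "j < d" "k < d" "l < d"
    and "M $$ (i * d + l, i * d + l) = 0"
  shows "M $$ (i * d + k, j * d + l) = 0"
proof -
  obtain PQs where PQs: "\<forall>(P, Q) \<in> set PQs. psd d P \<and> psd d Q"
    and M: "M = sum_mats (d * d) (map (\<lambda>(P, Q). kron P Q) PQs)"
    using assms(1) by (auto simp: separable_def)
  have "(\<Sum>(P, Q)\<leftarrow>PQs. P $$ (i, i) * Q $$ (l, l)) = 0"
    using assms(6) separable_index[OF PQs assms(2,2,5,5)] by (simp add: M)
  \<comment> \<open>Diagonal entries of positive semidefinite matrices are nonnegative, and a
    vanishing sum of nonnegative terms has only zero terms.\<close>
  then have "P $$ (i, i) * Q $$ (l, l) = 0" if "(P, Q) \<in> set PQs" for P Q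
    using PQs that
  proof (induction PQs)
    case (Cons R PQs)
    obtain P' Q' where R: "R = (P', Q')" by force
    have nonneg: "0 \<le> P $$ (i, i) * Q $$ (l, l)" if "(P, Q) \<in> set (R # PQs)" for P Q
      using that Cons.prems assms by (intro mult_nonneg_nonneg psd_diag_nonneg[of d]) auto
    have "0 \<le> (\<Sum>(P, Q)\<leftarrow>PQs. P $$ (i, i) * Q $$ (l, l))"
      by (rule sum_list_nonneg) (use nonneg in auto)
    moreover have "0 \<le> P' $$ (i, i) * Q' $$ (l, l)"
      using nonneg R by auto
    ultimately have "P' $$ (i, i) * Q' $$ (l, l) = 0"
      "(\<Sum>(P, Q)\<leftarrow>PQs. P $$ (i, i) * Q $$ (l, l)) = 0"
      using Cons.prems(1) R by (auto simp: add_nonneg_eq_0_iff)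
    then show ?case using Cons R by auto
  qed simp
  \<comment> \<open>Either \<open>P $$ (i, i) = 0\<close>, which clears row \<open>i\<close> of
    \<open>P\<close>, or \<open>Q $$ (l, l) = 0\<close>, which clears column \<open>l\<close> of
    \<open>Q\<close>.\<close>
  then have "P $$ (i, j) * Q $$ (k, l) = 0" if "(P, Q) \<in> set PQs" for P Q
    using that PQs assms psd_zero_diag(1)[of d P i j] psd_zero_diag(2)[of d Q l k] by fastforce
  then have "(\<Sum>(P, Q)\<leftarrow>PQs. P $$ (i, j) * Q $$ (k, l)) = 0"
    by (intro sum_list_neutral) auto
  then show ?thesis
    using separable_index[OF PQs assms(2-5)] by (simp add: M)
qed

section \<open>Channels that measure in the standard basis and, on outcome \<open>m\<close>, prepare
  the basis state \<open>p m\<close>\<close>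

definition relabel_kraus :: "nat \<Rightarrow> (nat \<Rightarrow> nat) \<Rightarrow> complex mat list" where
  "relabel_kraus d p = [mat_unit d (p m) m. m \<leftarrow> [0..<d]]"

lemma relabel_kraus_carrier: "set (relabel_kraus d p) \<subseteq> carrier_mat d d"
  by (auto simp: relabel_kraus_def)

lemma relabel_index:
  assumes "\<rho> \<in> carrier_mat d d" "i < d" "j < d"
  shows "kraus_sum d (relabel_kraus d p) \<rho> $$ (i, j) =
    (\<Sum>m<d. if p m = i \<and> p m = j then \<rho> $$ (m, m) else 0)"
proof -
  have "kraus_sum d (relabel_kraus d p) \<rho> $$ (i, j) =
      (\<Sum>l<d. \<Sum>k<d. \<Sum>m<d. \<rho> $$ (k, l) *
        (mat_unit d (p m) m $$ (i, k) * cnj (mat_unit d (p m) m $$ (j, l))))"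
    using assms
    by (simp add: kraus_sum_index[OF relabel_kraus_carrier] kraus_coeff_def)
       (simp add: relabel_kraus_def comp_def interv_sum_list_conv_sum_set_nat atLeast0LessThan
          sum_distrib_left)
  \<comment> \<open>A summand survives only for \<open>k = m = l\<close>, so the off-diagonal
    entries of \<open>\<rho>\<close> are lost.\<close>
  also have "\<dots> = (\<Sum>l<d. \<Sum>k<d. \<Sum>m<d. if m = k then if k = l then
      if p k = i \<and> p k = j then \<rho> $$ (k, k) else 0 else 0 else 0)"
    using assms by (intro sum.cong refl) (auto simp: mat_unit_def)
  also have "\<dots> = (\<Sum>m<d. if p m = i \<and> p m = j then \<rho> $$ (m, m) else 0)"
    by simp
  finally show ?thesis .
qed

text \<open>The trace is preserved because each diagonal entry \<open>X $$ (m, m)\<close> is moved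
  to exactly one position, \<open>p m\<close>, of the diagonal. The Choi matrix is separable because
  off-diagonal matrix units are sent to zero and the diagonal ones to diagonal ones.\<close>

lemma eb_channel_relabel:
  assumes p: "\<And>m. m < d \<Longrightarrow> p m < d"
  shows "eb_channel d (kraus_sum d (relabel_kraus d p))" (is "eb_channel d ?E")
proof -
  note lin = linear_map_kraus_sum[OF relabel_kraus_carrier]
  have cp: "cp_map d ?E" by (rule cp_map_kraus_sum[OF relabel_kraus_carrier])
  have "mat_trace (?E X) = mat_trace X" if X: "X \<in> carrier_mat d d" for X
  proof -
    have "mat_trace (?E X) = (\<Sum>i<d. \<Sum>m<d. if p m = i then X $$ (m, m) else 0)"
      using X by (simp add: mat_trace_def relabel_index
          carrier_matD[OF kraus_sum_carrier[OF relabel_kraus_carrier X]])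
    also have "\<dots> = (\<Sum>m<d. \<Sum>i<d. if p m = i then X $$ (m, m) else 0)"
      by (rule sum.swap)
    finally show ?thesis using X p by (simp add: mat_trace_def)
  qed
  moreover have "separable d (choi d ?E)"
    unfolding separable_def
  proof (intro exI conjI)
    \<comment> \<open>The measured projector at \<open>m\<close> is paired with the projector
      prepared on that outcome.\<close>
    let ?PQs = "map (\<lambda>m. (mat_unit d m m, mat_unit d (p m) (p m))) [0..<d]"
    show psd: "\<forall>(P, Q) \<in> set ?PQs. psd d P \<and> psd d Q"
      using p by (auto intro!: psd_mat_unit)
    show "choi d ?E = sum_mats (d * d) (map (\<lambda>(P, Q). kron P Q) ?PQs)"
    proof (rule eq_mat_blockI[OF choi_carrier[OF lin]])
      show "sum_mats (d * d) (map (\<lambda>(P, Q). kron P Q) ?PQs) \<in> carrier_mat (d * d) (d * d)"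
        by (intro sum_mats_carrier) auto
      fix i j k l assume *: "i < d" "j < d" "k < d" "l < d"
      have "choi d ?E $$ (i * d + k, j * d + l) =
          (\<Sum>m<d. if p m = k \<and> p m = l then mat_unit d i j $$ (m, m) else 0)"
        using * by (simp add: choi_index[OF lin] relabel_index)
      also have "\<dots> = (\<Sum>m<d. mat_unit d m m $$ (i, j) * mat_unit d (p m) (p m) $$ (k, l))"
        using * by (intro sum.cong refl) (auto simp: mat_unit_def)
      also have "\<dots> = (\<Sum>(P, Q)\<leftarrow>?PQs. P $$ (i, j) * Q $$ (k, l))"
        by (simp add: comp_def interv_sum_list_conv_sum_set_nat atLeast0LessThan)
      also have "\<dots> = sum_mats (d * d) (map (\<lambda>(P, Q). kron P Q) ?PQs) $$ (i * d + k, j * d + l)"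
        by (rule separable_index[OF psd *, symmetric])
      finally show "choi d ?E $$ (i * d + k, j * d + l) = \<dots>" .
    qed
  qed
  ultimately show ?thesis
    using cp by (simp add: eb_channel_def quantum_channel_def eb_cp_map_def)
qed

text \<open>The empty Kraus list gives the zero map, whose Choi matrix is the empty sum of products.
  The commutator branch of dephasing is this map.\<close>

lemma eb_cp_map_zero: "eb_cp_map d (kraus_sum d [])"
  unfolding eb_cp_map_def
proof
  show "cp_map d (kraus_sum d [])" by (rule cp_map_kraus_sum) simp
  have lin: "linear_map d (kraus_sum d [])" by (rule linear_map_kraus_sum) simp
  have "choi d (kraus_sum d []) = sum_mats (d * d) []"
    by (rule eq_mat_blockI[OF choi_carrier[OF lin]])
       (auto simp: choi_index[OF lin] kraus_sum_def sum_mats_def less_mult_add)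
  then show "separable d (choi d (kraus_sum d []))"
    unfolding separable_def by (intro exI[of _ "[]"]) simp
qed

section \<open>The qubit examples: dephasing and flip\<close>

lemma relabel_kraus_two: "relabel_kraus 2 p = [mat_unit 2 (p 0) 0, mat_unit 2 (p 1) 1]"
  by (simp add: relabel_kraus_def upt_rec numeral_2_eq_2)

lemma mat_unit_index:
  "k < n \<Longrightarrow> l < n \<Longrightarrow> mat_unit n i j $$ (k, l) = (if k = i \<and> l = j then 1 else 0)"
  by (simp add: mat_unit_def)

lemma mat_unit_times:
  assumes "j < n"
  shows "mat_unit n i j * mat_unit n k l = (if j = k then mat_unit n i l else 0\<^sub>m n n)"
proof (rule eq_matI)
  fix a b assume "a < dim_row (if j = k then mat_unit n i l else 0\<^sub>m n n)"
    "b < dim_col (if j = k then mat_unit n i l else 0\<^sub>m n n)"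
  then have ab: "a < n" "b < n" by (auto split: if_splits)
  have "(mat_unit n i j * mat_unit n k l) $$ (a, b) =
      (\<Sum>m<n. if m = j then if a = i \<and> j = k \<and> b = l then 1 else 0 else 0)"
  proof -
    have "(mat_unit n i j * mat_unit n k l) $$ (a, b) =
        (\<Sum>m<n. mat_unit n i j $$ (a, m) * mat_unit n k l $$ (m, b))"
      using ab by (simp add: scalar_prod_def atLeast0LessThan)
    also have "\<dots> = (\<Sum>m<n. if m = j then if a = i \<and> j = k \<and> b = l then 1 else 0 else 0)"
      using ab by (intro sum.cong refl) (auto simp: mat_unit_index)
    finally show ?thesis .
  qed
  then show "(mat_unit n i j * mat_unit n k l) $$ (a, b) =
      (if j = k then mat_unit n i l else 0\<^sub>m n n) $$ (a, b)"
    using ab assms by (simp add: mat_unit_index)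
qed auto

lemma kraus_sum_dim:
  assumes "set As \<subseteq> carrier_mat d d" "\<rho> \<in> carrier_mat d d"
  shows "dim_row (kraus_sum d As \<rho>) = d" "dim_col (kraus_sum d As \<rho>) = d"
  using kraus_sum_carrier[OF assms] by auto

lemma sum_lessThan_two: "(\<Sum>i<2::nat. f i) = f 0 + (f 1 :: 'a::comm_monoid_add)"
  by (simp add: numeral_2_eq_2)

lemma completely_useless_dephasing: "completely_useless 2 (kraus_sum 2 (relabel_kraus 2 id))"
proof -
  let ?L = "kraus_sum 2 (relabel_kraus 2 id)"
  have rep: "kraus_rep 2 (relabel_kraus 2 id) ?L"
    using relabel_kraus_carrier by (simp add: kraus_rep_def)
  have eb: "eb_channel 2 ?L" by (rule eb_channel_relabel) simp
  \<comment> \<open>The anticommutators are twice the Kraus operators for equal indices and zero for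
    different ones; the resulting factor 4 cancels the prefactor 1/4.\<close>
  have "branch_plus 2 ?L X = ?L X" if X: "X \<in> carrier_mat 2 2" for X
    unfolding branch_plus_eq[OF rep X] unfolding kraus_branch_plus_def relabel_kraus_two using X
    by (intro eq_matI)
       (auto simp: kraus_sum_index kraus_sum_dim kraus_coeff_def mat_unit_times mat_unit_index
          sum_lessThan_two less_2_cases_iff)
  \<comment> \<open>All commutators of the diagonal matrix units vanish.\<close>
  moreover have "branch_minus 2 ?L X = kraus_sum 2 [] X" if X: "X \<in> carrier_mat 2 2" for X
    unfolding branch_minus_eq[OF rep X] unfolding kraus_branch_minus_def relabel_kraus_two using X
    by (intro eq_matI)
       (auto simp: kraus_sum_index kraus_sum_dim kraus_coeff_def mat_unit_times mat_unit_index
          sum_lessThan_two less_2_cases_iff minus_carrier_mat)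
  ultimately show ?thesis
    using eb eb_cp_map_zero unfolding completely_useless_def
    by (auto simp: eb_channel_def intro: eb_cp_map_cong)
qed

text \<open>The minus branch keeps the coherence between the two basis states up to sign, so its
  Choi matrix has a nonzero entry between \<open>(0, 0)\<close> and \<open>(1, 1)\<close>, while its
  diagonal entry at \<open>(0, 1)\<close> is zero; \<open>separable_zero_diag\<close> excludes this.
  \<open>E\<close> is left general so that a composition of channels with these Kraus operators
  fits.\<close>

lemma useful_under_switch_flip:
  assumes "kraus_rep 2 (relabel_kraus 2 (\<lambda>m. 1 - m)) E"
  shows "useful_under_switch 2 E"
proof -
  let ?C = "branch_minus 2 E"
  \<comment> \<open>The nonzero commutators are \<sigma>_z and its negative. Each conjugates
    \<open>X\<close> to the same matrix, with the off-diagonal signs changed, and two such terms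
    times 1/4 give the factor 1/2.\<close>
  have C: "?C X $$ (i, j) = (if i = j then 1 else -1) / 2 * X $$ (i, j)"
    if X: "X \<in> carrier_mat 2 2" and ij: "i < 2" "j < 2" for X i j
  proof -
    let ?D = "mat_unit 2 1 1 - mat_unit 2 0 0" and ?D' = "mat_unit 2 0 0 - mat_unit 2 1 1"
    let ?Z = "0\<^sub>m 2 2 :: complex mat"
    have comm: "[A * B - B * A. A \<leftarrow> [mat_unit 2 1 0, mat_unit 2 0 1],
        B \<leftarrow> [mat_unit 2 1 0, mat_unit 2 0 1]]
      = [?Z, ?D, ?D', ?Z]"
      by (simp add: mat_unit_times)
    have sub: "set [?Z, ?D, ?D', ?Z] \<subseteq> carrier_mat 2 2"
      by (simp add: minus_carrier_mat)
    have "?C X = (1 / 4) \<cdot>\<^sub>m kraus_sum 2 [?Z, ?D, ?D', ?Z] X"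
      using branch_minus_eq[OF assms X] comm by (simp add: kraus_branch_minus_def relabel_kraus_two)
    moreover have "kraus_sum 2 [?Z, ?D, ?D', ?Z] X $$ (i, j) = (if i = j then 2 else - 2) * X $$ (i, j)"
    proof -
      have "i = 0 \<or> i = 1" "j = 0 \<or> j = 1" using ij by auto
      then show ?thesis
        unfolding kraus_sum_index[OF sub X ij] kraus_coeff_def sum_lessThan_two
        by (elim disjE; simp add: mat_unit_index)
    qed
    ultimately show ?thesis
      using ij kraus_sum_dim[OF sub X] by auto
  qed
  have "\<not> eb_cp_map 2 ?C"
  proof
    assume "eb_cp_map 2 ?C"
    then have lin: "linear_map 2 ?C" and sep: "separable 2 (choi 2 ?C)"
      by (auto simp: eb_cp_map_def cp_map_def)
    have choi: "choi 2 ?C $$ (i * 2 + k, j * 2 + l) =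
        (if k = l then 1 else -1) / 2 * mat_unit 2 i j $$ (k, l)"
      if "i < 2" "j < 2" "k < 2" "l < 2" for i j k l
      using that by (simp add: choi_index[OF lin] C)
    \<comment> \<open>Here \<open>i = k = 0\<close> and \<open>j = l = 1\<close>: the vanishing
      diagonal entry is the one of the image of \<open>mat_unit 2 0 0\<close> at
      \<open>(1, 1)\<close>. The entry itself is -1/2.\<close>
    have "choi 2 ?C $$ (0 * 2 + 0, 1 * 2 + 1) = 0"
      by (rule separable_zero_diag[OF sep]) (use choi[of 0 0 1 1] in \<open>auto simp: mat_unit_def\<close>)
    then show False using choi[of 0 1 0 1] by (simp add: mat_unit_def)
  qed
  then show ?thesis by (simp add: useful_under_switch_def)
qed

theorem mainTheorem3:
  shows "\<exists>(d::nat) \<Lambda> \<Phi>. 0 < d \<and> quantum_channel d \<Lambda> \<and> eb_channel d \<Phi> \<and>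
    completely_useless d \<Lambda> \<and> useful_under_switch d (\<Phi> \<circ> \<Lambda>)"
proof (intro exI conjI)
  let ?L = "kraus_sum 2 (relabel_kraus 2 id)"
  \<comment> \<open>On the indices 0 and 1, the map sending \<open>m\<close> to \<open>1 - m\<close>
    is the swap.\<close>
  let ?F = "kraus_sum 2 (relabel_kraus 2 (\<lambda>m. 1 - m))"
  show "(0::nat) < 2" by simp
  show useless: "completely_useless 2 ?L" by (rule completely_useless_dephasing)
  then show "quantum_channel 2 ?L" by (simp add: completely_useless_def eb_channel_def)
  show "eb_channel 2 ?F" by (rule eb_channel_relabel) simp
  \<comment> \<open>The flip channel reads only the diagonal of its argument, and dephasing leaves
    the diagonal unchanged.\<close>
  have "(?F \<circ> ?L) X = ?F X" if X: "X \<in> carrier_mat 2 2" for X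
  proof -
    note LX = kraus_sum_carrier[OF relabel_kraus_carrier X, of id]
    have "?L X $$ (m, m) = X $$ (m, m)" if "m < 2" for m
      using X that by (simp add: relabel_index)
    then show ?thesis
      using kraus_sum_carrier[OF relabel_kraus_carrier LX, of "\<lambda>m. 1 - m"]
        kraus_sum_carrier[OF relabel_kraus_carrier X, of "\<lambda>m. 1 - m"] X LX
      by (intro eq_matI) (auto simp: relabel_index intro!: sum.cong)
  qed
  then show "useful_under_switch 2 (?F \<circ> ?L)"
    using relabel_kraus_carrier by (intro useful_under_switch_flip) (auto simp: kraus_rep_def)
qed

end
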